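(* Let $\Omega$ be an arbitrary index set. Suppose $L : A_{\Omega} \rightarrow \mathbb{R}$ is a PSD linear map such that for each $j\in\Omega$ there exists a sequence $\{q_{jk}\}_{k=1}^{\infty}$ in $A_{\Omega}\otimes_{\mathbb{R}} \mathbb{C}$ with $$\lim_{k\rightarrow\infty}L\big(|1-(1+x_j^2)q_{jk}\overline{q_{jk}}|^2\big)=0,$$ and suppose $L(M)\subseteq [0,\infty)$ for some quadratic module $M$ of $A_{\Omega}$ which is the extension of a quadratic module of $A_I$ for some countable $I \subseteq \Omega$. Then the associated constructibly Radon measure $\nu$ on $\mathbb{R}^{\Omega}$, i.e. the unique constructibly Radon measure $\nu$ on $\mathbb{R}^\Omega$ (with finite moments) such that $L(f)=\int\hat f\,d\nu$ for all $f\in A_\Omega$, is supported by $X_M$.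
   Context: For $J\subseteq\Omega$, $A_J=\mathbb{R}[x_i\mid i\in J]$. For $f\in A_\Omega$, $\hat f:\mathbb{R}^\Omega\to\mathbb{R}$ is the evaluation function. $A_\Omega\otimes_{\mathbb{R}}\mathbb{C}=\mathbb{C}[x_i\mid i\in\Omega]$, $\overline q$ is obtained from $q$ by conjugating coefficients, and $|p|^2=p\overline p\in A_\Omega$. $L$ is PSD if it is $\ge0$ on finite sums of squares. A quadratic module of a commutative ring $D$ is a subset $M$ with $1\in M$, $M+M\subseteq M$ and $a^2M\subseteq M$ for all $a\in D$. The extension to $A_\Omega$ of a quadratic module $M_0$ of $A_I$ is the quadratic module of $A_\Omega$ generated by $M_0$. $X_M=\{\alpha\in\mathbb{R}^\Omega\mid\hat g(\alpha)\ge0\ \forall g\in M\}$. For a commutative $\mathbb{R}$-algebra $D$ with $1$, $X(D)$ is the set of unital ring homomorphisms $\alpha:D\to\mathbb{R}$ with the weakest topology making all $\hat a:\alpha\mapsto\alpha(a)$, $a\in D$, continuous. A subset of $X(D)$ is constructibly Borel if it lies in the $\sigma$-algebra generated by the sets $\{\alpha\in X(D)\mid\alpha(a)>0\}$, $a\in D$. A Radon measure is a positive, locally finite, inner regular (with respect to compact sets) measure on the Borel $\sigma$-algebra. A constructibly Radon measure on $X(D)$ is a positive measure on the $\sigma$-algebra of constructibly Borel sets such that, for each countably generated subalgebra $D'$ of $D$, its pushforward to $X(D')$ via $\alpha\mapsto\alpha|_{D'}$ is Radon. $\mathbb{R}^\Omega$ is identified with $X(A_\Omega)$ via point evaluations.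 By convention, a constructibly Radon measure $\nu$ on $\mathbb{R}^\Omega$ is required to have finite moments: $\int \hat f\,d\nu$ is well-defined and finite for every monomial $f$ in the $x_i$. It is a fact that, for PSD $L$ satisfying the displayed limit condition for every $j\in\Omega$, there exists a unique constructibly Radon measure $\nu$ on $\mathbb{R}^\Omega$ with $L(f)=\int\hat f\,d\nu$ for all $f\in A_\Omega$; this is the measure associated to $L$. A measure $\nu$ on $(X,\Sigma)$ is supported by $Y\subseteq X$ if $\nu(E)=0$ for every $E\in\Sigma$ with $E\cap Y=\emptyset$. *)

theory Defs
  imports "HOL-Analysis.Analysis" "HOL-Library.Poly_Mapping"
begin

section \<open>Polynomials in arbitrarily many variables\<close>

type_synonym ('i, 'a) mvpoly = "('i \<Rightarrow>\<^sub>0 nat) \<Rightarrow>\<^sub>0 'a"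

text \<open>\<open>poly_alg J\<close> consists of the polynomials in the variables \<open>x\<^sub>i\<close> with \<open>i \<in> J\<close>. It is used both for
  real coefficients and, as a model of the complexification, for complex coefficients.\<close>

definition poly_alg :: "'i set \<Rightarrow> ('i, 'a::zero) mvpoly set" where
  "poly_alg J = {p. \<forall>m \<in> Poly_Mapping.keys p. Poly_Mapping.keys m \<subseteq> J}"

definition const :: "'a::zero \<Rightarrow> ('i, 'a) mvpoly" where
  "const c = Poly_Mapping.single 0 c"

definition var :: "'i \<Rightarrow> ('i, 'a::zero_neq_one) mvpoly" where
  "var i = Poly_Mapping.single (Poly_Mapping.single i 1) 1"

definition monomial :: "('i \<Rightarrow>\<^sub>0 nat) \<Rightarrow> ('i, real) mvpoly" where
  "monomial m = Poly_Mapping.single m 1"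

definition eval :: "('i, real) mvpoly \<Rightarrow> ('i \<Rightarrow> real) \<Rightarrow> real" where
  "eval f \<alpha> = (\<Sum>m \<in> Poly_Mapping.keys f. Poly_Mapping.lookup f m *
      (\<Prod>i \<in> Poly_Mapping.keys m. \<alpha> i ^ Poly_Mapping.lookup m i))"

definition conj_poly :: "('i, complex) mvpoly \<Rightarrow> ('i, complex) mvpoly" where
  "conj_poly p = Poly_Mapping.map cnj p"

text \<open>The polynomial \<open>|p|\<^sup>2 = p * conj_poly p\<close> has real coefficients; \<open>sq_abs p\<close> is this polynomial as an
  element of the real polynomial ring, see the lemma \<open>of_real_sq_abs\<close>.\<close>

definition sq_abs :: "('i, complex) mvpoly \<Rightarrow> ('i, real) mvpoly" where
  "sq_abs p = Poly_Mapping.map Re (p * conj_poly p)"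

lemma lookup_conj_poly: "Poly_Mapping.lookup (conj_poly p) k = cnj (Poly_Mapping.lookup p k)"
  by (simp add: conj_poly_def Poly_Mapping.map.rep_eq when_def)

lemma conj_poly_conj_poly: "conj_poly (conj_poly p) = p"
  by (rule poly_mapping_eqI) (simp add: lookup_conj_poly)

lemma cnj_Sum_any: "cnj (Sum_any f) = Sum_any (\<lambda>x. cnj (f x))"
  by (simp add: Sum_any.expand_set)

lemma cnj_when: "cnj (a when P) = (cnj a when P)"
  by (simp add: when_def)

lemma conj_poly_mult: "conj_poly (p * q) = conj_poly p * conj_poly q"
  by (rule poly_mapping_eqI) (simp add: lookup_conj_poly lookup_mult cnj_Sum_any cnj_when)

lemma of_real_sq_abs: "Poly_Mapping.map complex_of_real (sq_abs p) = p * conj_poly p"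
proof (rule poly_mapping_eqI)
  fix k
  have "conj_poly (p * conj_poly p) = p * conj_poly p"
    by (simp add: conj_poly_mult conj_poly_conj_poly mult.commute)
  then have "cnj (Poly_Mapping.lookup (p * conj_poly p) k) = Poly_Mapping.lookup (p * conj_poly p) k"
    by (metis lookup_conj_poly)
  then have "complex_of_real (Re (Poly_Mapping.lookup (p * conj_poly p) k)) = Poly_Mapping.lookup (p * conj_poly p) k"
    by (simp add: complex_eq_iff)
  then show "Poly_Mapping.lookup (Poly_Mapping.map complex_of_real (sq_abs p)) k
      = Poly_Mapping.lookup (p * conj_poly p) k"
    by (auto simp add: sq_abs_def Poly_Mapping.map.rep_eq when_def)
qed


section \<open>Linear functionals and quadratic modules\<close>

definition linear_functional_on :: "('i, real) mvpoly set \<Rightarrow> (('i, real) mvpoly \<Rightarrow> real) \<Rightarrow> bool" where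
  "linear_functional_on D L \<longleftrightarrow>
     (\<forall>f\<in>D. \<forall>g\<in>D. L (f + g) = L f + L g) \<and> (\<forall>c. \<forall>f\<in>D. L (const c * f) = c * L f)"

definition PSD_on :: "('i, real) mvpoly set \<Rightarrow> (('i, real) mvpoly \<Rightarrow> real) \<Rightarrow> bool" where
  "PSD_on D L \<longleftrightarrow> (\<forall>fs. set fs \<subseteq> D \<longrightarrow> L (\<Sum>f\<leftarrow>fs. f\<^sup>2) \<ge> 0)"

definition quadratic_module :: "'a::comm_ring_1 set \<Rightarrow> 'a set \<Rightarrow> bool" where
  "quadratic_module D M \<longleftrightarrow> M \<subseteq> D \<and> 1 \<in> M \<and> (\<forall>a\<in>M. \<forall>b\<in>M. a + b \<in> M) \<and>
     (\<forall>a\<in>D. \<forall>b\<in>M. a\<^sup>2 * b \<in> M)"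

definition quadratic_module_extension :: "'i set \<Rightarrow> ('i, real) mvpoly set \<Rightarrow> ('i, real) mvpoly set" where
  "quadratic_module_extension \<Omega> M\<^sub>0 = quadratic_module (poly_alg \<Omega>) hull M\<^sub>0"

text \<open>The space \<open>\<real>\<^sup>\<Omega>\<close> is \<open>\<Omega> \<rightarrow>\<^sub>E UNIV\<close>: functions are \<open>undefined\<close> outside \<open>\<Omega>\<close>.\<close>

definition X_set :: "'i set \<Rightarrow> ('i, real) mvpoly set \<Rightarrow> ('i \<Rightarrow> real) set" where
  "X_set \<Omega> M = {\<alpha> \<in> \<Omega> \<rightarrow>\<^sub>E UNIV. \<forall>g\<in>M. eval g \<alpha> \<ge> 0}"


section \<open>Character spaces and constructibly Radon measures\<close>

definition subalgebra :: "('i, real) mvpoly set \<Rightarrow> bool" where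
  "subalgebra B \<longleftrightarrow> range const \<subseteq> B \<and> (\<forall>f\<in>B. \<forall>g\<in>B. f + g \<in> B \<and> f * g \<in> B)"

definition countably_generated_subalgebra :: "('i, real) mvpoly set \<Rightarrow> ('i, real) mvpoly set \<Rightarrow> bool" where
  "countably_generated_subalgebra D D' \<longleftrightarrow> (\<exists>S \<subseteq> D. countable S \<and> D' = subalgebra hull S)"

text \<open>A character of \<open>D\<close> is a unital ring homomorphism from \<open>D\<close> to \<open>\<real>\<close>; again the value outside \<open>D\<close>
  is \<open>undefined\<close>, so that characters of \<open>D\<close> are determined by their values on \<open>D\<close>.\<close>

definition chars :: "'a::comm_ring_1 set \<Rightarrow> ('a \<Rightarrow> real) set" where
  "chars D = {\<alpha> \<in> D \<rightarrow>\<^sub>E UNIV. \<alpha> 1 = 1 \<and>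
     (\<forall>a\<in>D. \<forall>b\<in>D. \<alpha> (a + b) = \<alpha> a + \<alpha> b \<and> \<alpha> (a * b) = \<alpha> a * \<alpha> b)}"

definition char_topology :: "'a::comm_ring_1 set \<Rightarrow> ('a \<Rightarrow> real) topology" where
  "char_topology D = topology_generated_by {{\<alpha> \<in> chars D. \<alpha> a \<in> U} |a U. a \<in> D \<and> open U}"

definition borel_of :: "'a topology \<Rightarrow> 'a measure" where
  "borel_of T = sigma (topspace T) {U. openin T U}"

definition constructible_borel :: "'a::comm_ring_1 set \<Rightarrow> ('a \<Rightarrow> real) measure" where
  "constructible_borel D = sigma (chars D) {{\<alpha> \<in> chars D. \<alpha> a > 0} |a. a \<in> D}"

definition Radon_measure :: "'a topology \<Rightarrow> 'a measure \<Rightarrow> bool" where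
  "Radon_measure T \<mu> \<longleftrightarrow> sets \<mu> = sets (borel_of T) \<and>
     (\<forall>x \<in> topspace T. \<exists>U. openin T U \<and> x \<in> U \<and> emeasure \<mu> U < \<infinity>) \<and>
     (\<forall>B \<in> sets \<mu>. emeasure \<mu> B = (SUP K \<in> {K. compactin T K \<and> K \<in> sets \<mu> \<and> K \<subseteq> B}. emeasure \<mu> K))"

definition constructibly_Radon :: "('i, real) mvpoly set \<Rightarrow> (('i, real) mvpoly \<Rightarrow> real) measure \<Rightarrow> bool" where
  "constructibly_Radon D \<mu> \<longleftrightarrow> sets \<mu> = sets (constructible_borel D) \<and>
     (\<forall>D'. countably_generated_subalgebra D D' \<longrightarrow>
        Radon_measure (char_topology D')
          (distr \<mu> (borel_of (char_topology D')) (\<lambda>\<alpha>. restrict \<alpha> D')))"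

definition point_evaluation :: "'i set \<Rightarrow> ('i \<Rightarrow> real) \<Rightarrow> (('i, real) mvpoly \<Rightarrow> real)" where
  "point_evaluation \<Omega> \<alpha> = (\<lambda>f \<in> poly_alg \<Omega>. eval f \<alpha>)"

text \<open>Constructibly Radon measures on \<open>\<real>\<^sup>\<Omega>\<close>, where \<open>\<real>\<^sup>\<Omega>\<close> is identified with the space of
  characters of \<open>poly_alg \<Omega>\<close> through the bijection \<open>point_evaluation \<Omega>\<close>. The last conjunct is the
  convention that all moments are finite.\<close>

definition constructibly_Radon_on_power :: "'i set \<Rightarrow> ('i \<Rightarrow> real) measure \<Rightarrow> bool" where
  "constructibly_Radon_on_power \<Omega> \<nu> \<longleftrightarrow>
     sets \<nu> = sets (vimage_algebra (\<Omega> \<rightarrow>\<^sub>E UNIV) (point_evaluation \<Omega>) (constructible_borel (poly_alg \<Omega>))) \<and>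
     constructibly_Radon (poly_alg \<Omega>)
       (distr \<nu> (constructible_borel (poly_alg \<Omega>)) (point_evaluation \<Omega>)) \<and>
     (\<forall>m. Poly_Mapping.keys m \<subseteq> \<Omega> \<longrightarrow> integrable \<nu> (eval (monomial m)))"

text \<open>That such a \<open>\<nu>\<close> exists and is unique, for PSD functionals satisfying the limit condition,
  is a known fact that the definition does not presuppose.\<close>

definition associated_measure ::
  "'i set \<Rightarrow> (('i, real) mvpoly \<Rightarrow> real) \<Rightarrow> ('i \<Rightarrow> real) measure \<Rightarrow> bool" where
  "associated_measure \<Omega> L \<nu> \<longleftrightarrow> constructibly_Radon_on_power \<Omega> \<nu> \<and>
     (\<forall>f \<in> poly_alg \<Omega>. L f = (\<integral>\<alpha>. eval f \<alpha> \<partial>\<nu>))"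

definition supported_by :: "'a measure \<Rightarrow> 'a set \<Rightarrow> bool" where
  "supported_by \<nu> Y \<longleftrightarrow> (\<forall>E \<in> sets \<nu>. E \<inter> Y = {} \<longrightarrow> emeasure \<nu> E = 0)"

end

theory Submission
  imports Defs
begin

text \<open>
  For \<open>g\<close> in the quadratic module and every polynomial \<open>h\<close> we have \<open>\<integral> h\<^sup>2 g d\<nu> = L(h\<^sup>2 g) \<ge> 0\<close>. The limit
  condition says that \<open>\<bar>q\<^sub>k\<bar>\<^sup>2\<close> tends to \<open>1 / (1 + x\<^sub>j\<^sup>2)\<close> in a weighted \<open>L\<^sup>2\<close> sense, so the inequality
  persists when \<open>h\<close> is a polynomial divided by a product \<open>d\<close> of factors \<open>1 + x\<^sub>j\<^sup>2\<close>. For a suitable \<open>d\<close> the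
  quotient \<open>g / d\<close> is bounded, and the one-variable Weierstrass theorem applied to functions of \<open>g / d\<close>
  yields enough such \<open>h\<close> to conclude that \<open>g \<ge> 0\<close> holds \<open>\<nu>\<close>-almost everywhere. Since the generators involve
  only countably many variables, countably many of them already cut out \<open>X\<^sub>M\<close>.
\<close>

section \<open>Positivity on squares for algebras of integrable functions\<close>


definition denom :: "('a \<Rightarrow> real) list \<Rightarrow> 'a \<Rightarrow> real" where
  "denom xs \<alpha> = (\<Prod>x\<leftarrow>xs. 1 + (x \<alpha>)\<^sup>2)"

lemma denom_Nil [simp]: "denom [] \<alpha> = 1"
  and denom_Cons [simp]: "denom (x # xs) \<alpha> = (1 + (x \<alpha>)\<^sup>2) * denom xs \<alpha>"
  by (simp_all add: denom_def)

lemma denom_append: "denom (xs @ ys) \<alpha> = denom xs \<alpha> * denom ys \<alpha>"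
  by (simp add: denom_def)

text \<open>A list may repeat its entries, so powers of denominators are denominators again.\<close>

lemma denom_concat_replicate: "denom (concat (replicate n xs)) \<alpha> = denom xs \<alpha> ^ n"
  by (induction n) (simp_all add: denom_append)

lemma denom_ge_1: "denom xs \<alpha> \<ge> 1"
proof (induction xs)
  case (Cons x xs)
  have "1 * 1 \<le> (1 + (x \<alpha>)\<^sup>2) * denom xs \<alpha>"
    by (rule mult_mono) (use Cons in auto)
  then show ?case by simp
qed simp

lemma denom_pos: "denom xs \<alpha> > 0"
  using denom_ge_1[of xs \<alpha>] by simp

text \<open>Abstracts from polynomial functions with finite moments: as products stay in
  \<open>A\<close>, all powers of members are integrable.\<close>

locale integrable_function_algebra =
  fixes \<nu> :: "'a measure" and A :: "('a \<Rightarrow> real) set"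
  assumes const_mem: "(\<lambda>_. c) \<in> A"
    and add_mem: "f \<in> A \<Longrightarrow> g \<in> A \<Longrightarrow> (\<lambda>x. f x + g x) \<in> A"
    and mult_mem: "f \<in> A \<Longrightarrow> g \<in> A \<Longrightarrow> (\<lambda>x. f x * g x) \<in> A"
    and integrable_mem: "f \<in> A \<Longrightarrow> integrable \<nu> f"
begin

lemma borel_measurable_mem: "f \<in> A \<Longrightarrow> f \<in> borel_measurable \<nu>"
  by (simp add: borel_measurable_integrable integrable_mem)

lemma power_mem: "f \<in> A \<Longrightarrow> (\<lambda>x. f x ^ n) \<in> A"
  by (induction n) (simp_all add: const_mem mult_mem)

lemma diff_mem: "f \<in> A \<Longrightarrow> g \<in> A \<Longrightarrow> (\<lambda>x. f x - g x) \<in> A"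
  using add_mem[OF _ mult_mem[OF const_mem[of "- 1"]], of f g] by simp

lemma sum_mem: "(\<And>i. i \<in> I \<Longrightarrow> f i \<in> A) \<Longrightarrow> (\<lambda>x. \<Sum>i\<in>I. f i x) \<in> A"
  by (induction I rule: infinite_finite_induct) (simp_all add: const_mem add_mem)

text \<open>\<open>u k\<close> and \<open>v k\<close> stand for the real and imaginary parts of
  \<open>q_k\<close>, so that \<open>|q_k|^2 = u^2 + v^2\<close> and the integrals are the
  quantities of the limit condition.\<close>

definition inverse_approximable :: "('a \<Rightarrow> real) set" where
  "inverse_approximable = {x \<in> A. \<exists>u v. (\<forall>k::nat. u k \<in> A \<and> v k \<in> A) \<and>
     (\<lambda>k. \<integral>\<alpha>. (1 - (1 + (x \<alpha>)\<^sup>2) * ((u k \<alpha>)\<^sup>2 + (v k \<alpha>)\<^sup>2))\<^sup>2 \<partial>\<nu>) \<longlonglongrightarrow> 0}"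

lemma denom_mem: "set xs \<subseteq> A \<Longrightarrow> denom xs \<in> A"
proof (induction xs)
  case Nil
  then show ?case using const_mem[of 1] by (simp add: denom_def)
next
  case (Cons x xs)
  then have "(\<lambda>\<alpha>. (1 + x \<alpha> ^ 2) * denom xs \<alpha>) \<in> A"
    by (intro mult_mem add_mem power_mem const_mem) auto
  then show ?case by (simp add: denom_Cons[abs_def])
qed

text \<open>Denominators are at least 1, so division by one only shrinks absolute values.\<close>

lemma integrable_div_denom:
  assumes "f \<in> A" "set xs \<subseteq> A"
  shows "integrable \<nu> (\<lambda>\<alpha>. f \<alpha> / denom xs \<alpha>)"
proof (rule Bochner_Integration.integrable_bound[OF integrable_mem[OF assms(1)]])
  have [measurable]: "denom xs \<in> borel_measurable \<nu>" "f \<in> borel_measurable \<nu>"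
    using denom_mem assms borel_measurable_mem by auto
  show "(\<lambda>\<alpha>. f \<alpha> / denom xs \<alpha>) \<in> borel_measurable \<nu>" by simp
  have "\<bar>f \<alpha> / denom xs \<alpha>\<bar> \<le> \<bar>f \<alpha>\<bar>" for \<alpha>
    using denom_ge_1[of xs \<alpha>] by (simp add: divide_le_eq mult_le_cancel_left1)
  then show "AE \<alpha> in \<nu>. norm (f \<alpha> / denom xs \<alpha>) \<le> norm (f \<alpha>)"
    by simp
qed

text \<open>The functional \<open>f \<mapsto> \<integral> f g\<close> is nonnegative on squares also after adjoining the inverses of the
  \<open>1 + x\<^sup>2\<close>: with \<open>\<bar>q\<^sub>k\<bar>\<^sup>2 = u\<^sub>k\<^sup>2 + v\<^sub>k\<^sup>2 \<rightarrow> 1 / (1 + x\<^sup>2)\<close>, each inverse is a limit of sums of two squares.\<close>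

lemma integral_sq_mult_div_denom_nonneg:
  assumes g: "g \<in> A" and pos: "\<And>h. h \<in> A \<Longrightarrow> (\<integral>\<alpha>. (h \<alpha>)\<^sup>2 * g \<alpha> \<partial>\<nu>) \<ge> 0"
    and xs: "set xs \<subseteq> inverse_approximable" and h: "h \<in> A"
  shows "(\<integral>\<alpha>. (h \<alpha>)\<^sup>2 * g \<alpha> / denom xs \<alpha> \<partial>\<nu>) \<ge> 0"
  using xs h
proof (induction xs arbitrary: h)
  case Nil
  then show ?case using pos by simp
next
  case (Cons x xs)
  then obtain u v where x: "x \<in> A" and u: "\<And>k::nat. u k \<in> A" and v: "\<And>k. v k \<in> A"
    and lim: "(\<lambda>k. \<integral>\<alpha>. (1 - (1 + (x \<alpha>)\<^sup>2) * ((u k \<alpha>)\<^sup>2 + (v k \<alpha>)\<^sup>2))\<^sup>2 \<partial>\<nu>) \<longlonglongrightarrow> 0"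
    unfolding inverse_approximable_def by simp blast
  have xsA: "set xs \<subseteq> A" "set (x # xs) \<subseteq> A"
    using Cons.prems by (auto simp: inverse_approximable_def)
  note mem = mult_mem add_mem power_mem const_mem diff_mem g Cons.prems(2) u v x
  \<comment> \<open>\<open>F\<close> is the target integrand and \<open>G k\<close> the defect of
    \<open>|q_k|^2\<close> as an inverse of \<open>1 + x^2\<close>; by \<open>lim\<close>,
    \<open>G k\<close> tends to 0 in mean square.\<close>
  define F where "F \<alpha> = (h \<alpha>)\<^sup>2 * g \<alpha> / denom (x # xs) \<alpha>" for \<alpha>
  define G where "G k \<alpha> = 1 - (1 + (x \<alpha>)\<^sup>2) * ((u k \<alpha>)\<^sup>2 + (v k \<alpha>)\<^sup>2)" for k \<alpha>
  have GA: "G k \<in> A" for k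
    unfolding G_def by (intro mem)
  have F: "integrable \<nu> F"
    unfolding F_def by (intro integrable_div_denom mem xsA)
  have F2: "integrable \<nu> (\<lambda>\<alpha>. (F \<alpha>)\<^sup>2)"
  proof -
    have "(\<lambda>\<alpha>. ((h \<alpha>)\<^sup>2 * g \<alpha>)\<^sup>2) \<in> A" by (intro mem)
    \<comment> \<open>The square of a denominator is the denominator of the doubled list.\<close>
    then have "integrable \<nu> (\<lambda>\<alpha>. ((h \<alpha>)\<^sup>2 * g \<alpha>)\<^sup>2 / denom ((x # xs) @ (x # xs)) \<alpha>)"
      by (rule integrable_div_denom) (use xsA in auto)
    then show ?thesis
      by (simp only: F_def power_divide denom_append power2_eq_square[of "denom _ _"])
  qed
  have G2: "integrable \<nu> (\<lambda>\<alpha>. (G k \<alpha>)\<^sup>2)" for k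
    by (intro integrable_mem power_mem GA)
  \<comment> \<open>The error \<open>F * G k\<close> is split by a Young inequality with free weight
    \<open>e\<close>; afterwards \<open>k\<close> goes to infinity first, then \<open>e\<close> to
    0.\<close>
  have key: "0 \<le> integral\<^sup>L \<nu> F + e * (\<integral>\<alpha>. (F \<alpha>)\<^sup>2 \<partial>\<nu>) + (\<integral>\<alpha>. (G k \<alpha>)\<^sup>2 \<partial>\<nu>) / e"
    if e: "e > 0" for k e
  proof -
    \<comment> \<open>\<open>P\<close> and \<open>Q\<close> contain the squares of
      \<open>h * u k\<close> and \<open>h * v k\<close> and one denominator factor fewer, so the
      induction hypothesis covers both.\<close>
    define P where "P \<alpha> = (h \<alpha> * u k \<alpha>)\<^sup>2 * g \<alpha> / denom xs \<alpha>" for \<alpha>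
    define Q where "Q \<alpha> = (h \<alpha> * v k \<alpha>)\<^sup>2 * g \<alpha> / denom xs \<alpha>" for \<alpha>
    have PQ: "integrable \<nu> P" "integrable \<nu> Q"
      unfolding P_def Q_def by (intro integrable_div_denom mem xsA)+
    have "integral\<^sup>L \<nu> P \<ge> 0" "integral\<^sup>L \<nu> Q \<ge> 0"
      unfolding P_def Q_def using Cons.prems by (auto intro!: Cons.IH mem)
    then have "0 \<le> (\<integral>\<alpha>. P \<alpha> + Q \<alpha> \<partial>\<nu>)"
      using PQ by simp
    also have "\<dots> \<le> (\<integral>\<alpha>. F \<alpha> + e * (F \<alpha>)\<^sup>2 + (G k \<alpha>)\<^sup>2 / e \<partial>\<nu>)"
    proof (rule integral_mono)
      show "P \<alpha> + Q \<alpha> \<le> F \<alpha> + e * (F \<alpha>)\<^sup>2 + (G k \<alpha>)\<^sup>2 / e" for \<alpha>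
      proof -
        have nz: "1 + (x \<alpha>)\<^sup>2 \<noteq> 0" "denom xs \<alpha> \<noteq> 0"
          using denom_pos[of xs \<alpha>] by (auto simp: add_nonneg_eq_0_iff)
        have eq: "(1 + (x \<alpha>)\<^sup>2) * F \<alpha> = (h \<alpha>)\<^sup>2 * g \<alpha> / denom xs \<alpha>"
          unfolding F_def denom_Cons using nz by simp
        have "P \<alpha> + Q \<alpha> = ((h \<alpha>)\<^sup>2 * g \<alpha> / denom xs \<alpha>) * ((u k \<alpha>)\<^sup>2 + (v k \<alpha>)\<^sup>2)"
          by (simp add: P_def Q_def power_mult_distrib algebra_simps add_divide_distrib)
        \<comment> \<open>Here \<open>(1 + x^2) * (u^2 + v^2) = 1 - G k\<close>.\<close>
        also have "\<dots> = F \<alpha> - F \<alpha> * G k \<alpha>"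
          unfolding eq[symmetric] G_def by (simp add: algebra_simps)
        finally have "P \<alpha> + Q \<alpha> = F \<alpha> - F \<alpha> * G k \<alpha>" .
        moreover have "- (F \<alpha> * G k \<alpha>) \<le> e * (F \<alpha>)\<^sup>2 + (G k \<alpha>)\<^sup>2 / e"
        proof -
          \<comment> \<open>The right side expands to
            \<open>2 * ((e F)^2 + e F G + G^2)\<close>.\<close>
          have "0 \<le> (e * F \<alpha> + G k \<alpha>)\<^sup>2 + (e * F \<alpha>)\<^sup>2 + (G k \<alpha>)\<^sup>2" by simp
          then have "- (F \<alpha> * G k \<alpha>) * e \<le> (e * F \<alpha>)\<^sup>2 + (G k \<alpha>)\<^sup>2"
            by (simp add: power2_eq_square algebra_simps)
          then have "- (F \<alpha> * G k \<alpha>) \<le> ((e * F \<alpha>)\<^sup>2 + (G k \<alpha>)\<^sup>2) / e"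
            using e by (simp add: pos_le_divide_eq)
          also have "\<dots> = e * (F \<alpha>)\<^sup>2 + (G k \<alpha>)\<^sup>2 / e"
            using e by (simp add: field_simps power2_eq_square)
          finally show ?thesis .
        qed
        ultimately show ?thesis by linarith
      qed
    qed (use F F2 G2 PQ in auto)
    also have "\<dots> = integral\<^sup>L \<nu> F + e * (\<integral>\<alpha>. (F \<alpha>)\<^sup>2 \<partial>\<nu>) + (\<integral>\<alpha>. (G k \<alpha>)\<^sup>2 \<partial>\<nu>) / e"
      using F F2 G2 by simp
    finally show ?thesis .
  qed
  have "0 \<le> integral\<^sup>L \<nu> F + e * (\<integral>\<alpha>. (F \<alpha>)\<^sup>2 \<partial>\<nu>)" if e: "e > 0" for e
  proof (rule LIMSEQ_le_const)
    show "(\<lambda>k. integral\<^sup>L \<nu> F + e * (\<integral>\<alpha>. (F \<alpha>)\<^sup>2 \<partial>\<nu>) + (\<integral>\<alpha>. (G k \<alpha>)\<^sup>2 \<partial>\<nu>) / e)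
        \<longlonglongrightarrow> integral\<^sup>L \<nu> F + e * (\<integral>\<alpha>. (F \<alpha>)\<^sup>2 \<partial>\<nu>)"
      using tendsto_add[OF tendsto_const tendsto_divide[OF lim[folded G_def] tendsto_const, of e]] e
      by simp
  qed (use key[OF e] in auto)
  moreover have "((\<lambda>e. integral\<^sup>L \<nu> F + e * (\<integral>\<alpha>. (F \<alpha>)\<^sup>2 \<partial>\<nu>)) \<longlongrightarrow> integral\<^sup>L \<nu> F + 0 * (\<integral>\<alpha>. (F \<alpha>)\<^sup>2 \<partial>\<nu>))
      (at_right 0)"
    by (intro tendsto_intros)
  ultimately have "0 \<le> integral\<^sup>L \<nu> F + 0 * (\<integral>\<alpha>. (F \<alpha>)\<^sup>2 \<partial>\<nu>)"
    by (intro tendsto_lowerbound[where F = "at_right (0::real)"])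
      (auto simp: eventually_at_filter)
  then show ?case by (simp add: F_def[abs_def])
qed

text \<open>As \<open>t = g / denom xs\<close> is bounded, \<open>s(t) = sqrt (max 0 (- t))\<close> is a uniform limit of polynomials in
  \<open>t\<close>. Hence \<open>\<integral> s(t)\<^sup>2 g \<ge> 0\<close>, although \<open>s(t)\<^sup>2 g \<le> 0\<close> with equality only where \<open>g \<ge> 0\<close>.\<close>

lemma AE_nonneg_of_integral_sq_mult_nonneg:
  assumes g: "g \<in> A" and pos: "\<And>h. h \<in> A \<Longrightarrow> (\<integral>\<alpha>. (h \<alpha>)\<^sup>2 * g \<alpha> \<partial>\<nu>) \<ge> 0"
    and xs: "set xs \<subseteq> inverse_approximable" and bound: "\<And>\<alpha>. \<bar>g \<alpha>\<bar> \<le> C * denom xs \<alpha>"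
  shows "AE \<alpha> in \<nu>. g \<alpha> \<ge> 0"
proof -
  have xsA: "set xs \<subseteq> A"
    using xs by (auto simp: inverse_approximable_def)
  have gm [measurable]: "g \<in> borel_measurable \<nu>" "denom xs \<in> borel_measurable \<nu>"
    using g denom_mem[OF xsA] borel_measurable_mem by auto
  define t where "t \<alpha> = g \<alpha> / denom xs \<alpha>" for \<alpha>
  have tm [measurable]: "t \<in> borel_measurable \<nu>" unfolding t_def by measurable
  have t: "t \<alpha> \<in> {-C..C}" for \<alpha>
    using bound[of \<alpha>] denom_pos[of xs \<alpha>] unfolding t_def
    by (auto simp: abs_le_iff pos_divide_le_eq pos_le_divide_eq minus_le_iff)
  define s :: "real \<Rightarrow> real" where "s y = sqrt (max 0 (- y))" for y
  have contS: "continuous_on {-C..C} s"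
    unfolding s_def by (intro continuous_intros)
  have "\<exists>p. real_polynomial_function p \<and> (\<forall>y\<in>{-C..C}. \<bar>s y - p y\<bar> < 1 / Suc n)" for n
    by (rule Stone_Weierstrass_real_polynomial_function[OF compact_Icc contS, of "1 / Suc n"]) auto
  then obtain p where p: "\<And>n. real_polynomial_function (p n)"
    and sp: "\<And>n y. y \<in> {-C..C} \<Longrightarrow> \<bar>s y - p n y\<bar> < 1 / Suc n"
    by metis
  have p_pos: "0 \<le> (\<integral>\<alpha>. (p n (t \<alpha>))\<^sup>2 * g \<alpha> \<partial>\<nu>)" for n
  proof -
    obtain a d where pd: "p n = (\<lambda>y. \<Sum>i\<le>d. a i * y ^ i)"
      using real_polynomial_function_imp_sum[OF p] by blast
    \<comment> \<open>Clearing denominators in \<open>p n (g / denom xs)\<close>, a polynomial of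
      degree at most \<open>d\<close>, leaves a member of \<open>A\<close>.\<close>
    define f where "f \<alpha> = (\<Sum>i\<le>d. a i * (g \<alpha> ^ i * denom xs \<alpha> ^ (d - i)))" for \<alpha>
    have fA: "f \<in> A"
      unfolding f_def by (intro sum_mem mult_mem power_mem const_mem denom_mem g xsA)
    have "p n (t \<alpha>) = f \<alpha> / denom xs \<alpha> ^ d" for \<alpha>
      unfolding pd f_def sum_divide_distrib t_def
    proof (rule sum.cong)
      fix i assume "i \<in> {..d}"
      then have "denom xs \<alpha> ^ d = denom xs \<alpha> ^ i * denom xs \<alpha> ^ (d - i)"
        by (simp flip: power_add)
      then show "a i * (g \<alpha> / denom xs \<alpha>) ^ i = a i * (g \<alpha> ^ i * denom xs \<alpha> ^ (d - i)) / denom xs \<alpha> ^ d"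
        using denom_pos[of xs \<alpha>] by (simp add: power_divide)
    qed simp
    \<comment> \<open>Squaring doubles the exponent of the denominator, hence \<open>2 * d\<close>
      copies of \<open>xs\<close>.\<close>
    then have eq: "(p n (t \<alpha>))\<^sup>2 * g \<alpha> = (f \<alpha>)\<^sup>2 * g \<alpha> / denom (concat (replicate (2 * d) xs)) \<alpha>" for \<alpha>
      unfolding denom_concat_replicate by (simp add: power_divide mult.commute[of 2] flip: power_mult)
    show ?thesis
      unfolding eq by (rule integral_sq_mult_div_denom_nonneg[OF g pos _ fA]) (use xs in auto)
  qed
  have "(\<lambda>n. \<integral>\<alpha>. (p n (t \<alpha>))\<^sup>2 * g \<alpha> \<partial>\<nu>) \<longlonglongrightarrow> (\<integral>\<alpha>. (s (t \<alpha>))\<^sup>2 * g \<alpha> \<partial>\<nu>)"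
  proof (rule integral_dominated_convergence)
    show "(\<lambda>\<alpha>. (s (t \<alpha>))\<^sup>2 * g \<alpha>) \<in> borel_measurable \<nu>"
      unfolding s_def by measurable
    have "p n \<in> borel_measurable borel" for n
      using p[of n] by (intro borel_measurable_continuous_onI continuous_on_polymonial_function)
        (simp add: real_polynomial_function_eq)
    then show "(\<lambda>\<alpha>. (p n (t \<alpha>))\<^sup>2 * g \<alpha>) \<in> borel_measurable \<nu>" for n
      by measurable
    \<comment> \<open>On \<open>{-C..C}\<close> the function \<open>s\<close> is at most
      \<open>sqrt C\<close>, and each \<open>p n\<close> is within \<open>1 / Suc n \<le> 1\<close>
      of it.\<close>
    show "integrable \<nu> (\<lambda>\<alpha>. (sqrt C + 1)\<^sup>2 * \<bar>g \<alpha>\<bar>)"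
      using integrable_mem[OF g] by simp
    show "AE \<alpha> in \<nu>. (\<lambda>n. (p n (t \<alpha>))\<^sup>2 * g \<alpha>) \<longlonglongrightarrow> (s (t \<alpha>))\<^sup>2 * g \<alpha>"
    proof (rule AE_I2)
      fix \<alpha>
      have "(\<lambda>n. p n (t \<alpha>)) \<longlonglongrightarrow> s (t \<alpha>)"
      proof (rule LIM_zero_cancel, rule tendsto_0_le[where K = 1, OF LIMSEQ_inverse_real_of_nat])
        show "\<forall>\<^sub>F n in sequentially. norm (p n (t \<alpha>) - s (t \<alpha>)) \<le> norm (inverse (real (Suc n))) * 1"
          using sp[OF t] by (intro always_eventually allI) (auto simp: abs_minus_commute inverse_eq_divide intro: less_imp_le)
      qed
      then show "(\<lambda>n. (p n (t \<alpha>))\<^sup>2 * g \<alpha>) \<longlonglongrightarrow> (s (t \<alpha>))\<^sup>2 * g \<alpha>"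
        by (intro tendsto_intros)
    qed
    show "AE \<alpha> in \<nu>. norm ((p n (t \<alpha>))\<^sup>2 * g \<alpha>) \<le> (sqrt C + 1)\<^sup>2 * \<bar>g \<alpha>\<bar>" for n
    proof (rule AE_I2)
      fix \<alpha>
      have "\<bar>s (t \<alpha>)\<bar> \<le> sqrt C"
        using t[of \<alpha>] by (auto simp: s_def)
      moreover have "\<bar>s (t \<alpha>) - p n (t \<alpha>)\<bar> < 1 / Suc n" "1 / Suc n \<le> 1"
        using sp[OF t] by auto
      ultimately have "\<bar>p n (t \<alpha>)\<bar> \<le> sqrt C + 1"
        by linarith
      then have "(p n (t \<alpha>))\<^sup>2 \<le> (sqrt C + 1)\<^sup>2"
        using power_mono[of "\<bar>p n (t \<alpha>)\<bar>" "sqrt C + 1" 2] by simp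
      then show "norm ((p n (t \<alpha>))\<^sup>2 * g \<alpha>) \<le> (sqrt C + 1)\<^sup>2 * \<bar>g \<alpha>\<bar>"
        by (simp add: abs_mult mult_right_mono)
    qed
  qed
  then have nonneg: "0 \<le> (\<integral>\<alpha>. (s (t \<alpha>))\<^sup>2 * g \<alpha> \<partial>\<nu>)"
    by (rule LIMSEQ_le_const) (use p_pos in auto)
  \<comment> \<open>Where \<open>g < 0\<close>, \<open>s(t)^2 = - t\<close> and so
    \<open>r = g^2 / denom xs > 0\<close>; elsewhere \<open>r = 0\<close>. As the integral of
    \<open>r\<close> is at most 0 by \<open>nonneg\<close>, \<open>r\<close> vanishes almost
    everywhere.\<close>
  define r where "r \<alpha> = - ((s (t \<alpha>))\<^sup>2 * g \<alpha>)" for \<alpha>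
  have r_eq: "r \<alpha> = (if g \<alpha> < 0 then t \<alpha> * g \<alpha> else 0)" for \<alpha>
    using denom_pos[of xs \<alpha>] by (simp add: r_def s_def t_def divide_less_0_iff)
  have r: "r \<alpha> \<ge> 0" "r \<alpha> = 0 \<Longrightarrow> g \<alpha> \<ge> 0" for \<alpha>
    unfolding r_eq t_def using denom_pos[of xs \<alpha>] by (auto split: if_splits)
  have "integrable \<nu> r"
  proof (rule Bochner_Integration.integrable_bound)
    show "integrable \<nu> (\<lambda>\<alpha>. C * \<bar>g \<alpha>\<bar>)" using integrable_mem[OF g] by simp
    show "r \<in> borel_measurable \<nu>" unfolding r_def s_def by measurable
    have "norm (r \<alpha>) \<le> norm (C * \<bar>g \<alpha>\<bar>)" for \<alpha>
      using t[of \<alpha>] by (auto simp: r_eq abs_mult intro!: mult_right_mono)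
    then show "AE \<alpha> in \<nu>. norm (r \<alpha>) \<le> norm (C * \<bar>g \<alpha>\<bar>)" by simp
  qed
  moreover have "integral\<^sup>L \<nu> r = 0"
  proof (rule antisym)
    show "integral\<^sup>L \<nu> r \<le> 0"
      using nonneg by (simp add: r_def[abs_def])
  qed (use r(1) in \<open>simp add: integral_nonneg_AE\<close>)
  ultimately have "AE \<alpha> in \<nu>. r \<alpha> = 0"
    using integral_nonneg_eq_0_iff_AE r(1) by blast
  then show ?thesis
    by eventually_elim (use r(2) in auto)
qed

end


section \<open>Evaluation of polynomials\<close>


definition monomial_eval :: "('i \<Rightarrow>\<^sub>0 nat) \<Rightarrow> ('i \<Rightarrow> real) \<Rightarrow> real" where
  "monomial_eval m \<alpha> = (\<Prod>i \<in> Poly_Mapping.keys m. \<alpha> i ^ Poly_Mapping.lookup m i)"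

lemma monomial_eval_superset:
  assumes "finite S" "Poly_Mapping.keys m \<subseteq> S"
  shows "monomial_eval m \<alpha> = (\<Prod>i\<in>S. \<alpha> i ^ Poly_Mapping.lookup m i)"
  unfolding monomial_eval_def
  by (rule prod.mono_neutral_left) (use assms in \<open>auto simp: in_keys_iff\<close>)

lemma monomial_eval_0 [simp]: "monomial_eval 0 \<alpha> = 1"
  by (simp add: monomial_eval_def)

lemma monomial_eval_single_1 [simp]: "monomial_eval (Poly_Mapping.single i 1) \<alpha> = \<alpha> i"
  by (simp add: monomial_eval_def)

lemma monomial_eval_add: "monomial_eval (m + n) \<alpha> = monomial_eval m \<alpha> * monomial_eval n \<alpha>"
proof -
  let ?S = "Poly_Mapping.keys m \<union> Poly_Mapping.keys n"
  have "Poly_Mapping.keys (m + n) \<subseteq> ?S"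
    by (rule Poly_Mapping.keys_add)
  then show ?thesis
    by (simp add: monomial_eval_superset[of ?S] lookup_add power_add prod.distrib)
qed

text \<open>Extends \<open>eval\<close> to complex coefficients at real points, so that
  \<open>q_k\<close> and its conjugate can be evaluated.\<close>

definition eval_at :: "('i \<Rightarrow> real) \<Rightarrow> ('i, 'a::real_field) mvpoly \<Rightarrow> 'a" where
  "eval_at \<alpha> f = (\<Sum>m\<in>Poly_Mapping.keys f. Poly_Mapping.lookup f m * of_real (monomial_eval m \<alpha>))"

lemma eval_eq_eval_at: "eval f \<alpha> = eval_at \<alpha> f"
  by (simp add: eval_def eval_at_def monomial_eval_def)

text \<open>A common finite index set allows termwise comparison of polynomials with different
  supports.\<close>

lemma eval_at_superset:
  assumes "finite S" "Poly_Mapping.keys f \<subseteq> S"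
  shows "eval_at \<alpha> f = (\<Sum>m\<in>S. Poly_Mapping.lookup f m * of_real (monomial_eval m \<alpha>))"
  unfolding eval_at_def
  by (rule sum.mono_neutral_left) (use assms in \<open>auto simp: in_keys_iff\<close>)

lemma eval_at_0 [simp]: "eval_at \<alpha> 0 = 0"
  by (simp add: eval_at_def)

lemma eval_at_single [simp]: "eval_at \<alpha> (Poly_Mapping.single m c) = c * of_real (monomial_eval m \<alpha>)"
  by (simp add: eval_at_def)

lemma eval_at_1 [simp]: "eval_at \<alpha> 1 = 1"
  using eval_at_single[of \<alpha> 0 1] by simp

lemma eval_at_add: "eval_at \<alpha> (f + g) = eval_at \<alpha> f + eval_at \<alpha> g"
proof -
  let ?S = "Poly_Mapping.keys f \<union> Poly_Mapping.keys g"
  have "Poly_Mapping.keys (f + g) \<subseteq> ?S"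
    by (rule Poly_Mapping.keys_add)
  then show ?thesis
    by (simp add: eval_at_superset[of ?S] lookup_add sum.distrib distrib_right)
qed

lemma eval_at_diff: "eval_at \<alpha> (f - g) = eval_at \<alpha> f - eval_at \<alpha> g"
  using eval_at_add[of \<alpha> "f - g" g] by simp

lemma eval_at_sum: "eval_at \<alpha> (\<Sum>i\<in>I. f i) = (\<Sum>i\<in>I. eval_at \<alpha> (f i))"
  by (induction I rule: infinite_finite_induct) (simp_all add: eval_at_add)

lemma poly_mapping_eq_sum_single:
  fixes f :: "'k \<Rightarrow>\<^sub>0 'b::comm_monoid_add"
  shows "f = (\<Sum>k\<in>Poly_Mapping.keys f. Poly_Mapping.single k (Poly_Mapping.lookup f k))"
  by (rule poly_mapping_eqI) (simp add: lookup_sum lookup_single when_def in_keys_iff)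

text \<open>Both factors expand into single terms, where \<open>monomial_eval_add\<close> gives
  multiplicativity.\<close>

lemma eval_at_mult: "eval_at \<alpha> (f * g) = eval_at \<alpha> f * eval_at \<alpha> g"
proof -
  let ?s = "\<lambda>f k. Poly_Mapping.single k (Poly_Mapping.lookup f k)"
  have "f * g = (\<Sum>k\<in>Poly_Mapping.keys f. ?s f k) * (\<Sum>k\<in>Poly_Mapping.keys g. ?s g k)"
    by (simp flip: poly_mapping_eq_sum_single)
  then have "eval_at \<alpha> (f * g) = (\<Sum>k\<in>Poly_Mapping.keys f. \<Sum>l\<in>Poly_Mapping.keys g. eval_at \<alpha> (?s f k * ?s g l))"
    by (simp add: sum_product eval_at_sum)
  also have "\<dots> = eval_at \<alpha> f * eval_at \<alpha> g"
    by (simp only: mult_single eval_at_single monomial_eval_add)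
      (simp add: eval_at_def sum_product mult_ac)
  finally show ?thesis .
qed

lemma eval_at_power: "eval_at \<alpha> (f ^ n) = eval_at \<alpha> f ^ n"
  by (induction n) (simp_all add: eval_at_mult)

lemma eval_at_const [simp]: "eval_at \<alpha> (const c) = c"
  by (simp add: const_def)

lemma eval_at_var [simp]: "eval_at \<alpha> (var i) = of_real (\<alpha> i)"
  by (simp add: var_def del: One_nat_def)

lemma eval_at_map:
  fixes f :: "('i, 'a::real_field) mvpoly" and h :: "'a \<Rightarrow> 'b::real_field"
  assumes "h 0 = 0"
  shows "eval_at \<alpha> (Poly_Mapping.map h f) =
    (\<Sum>m\<in>Poly_Mapping.keys f. h (Poly_Mapping.lookup f m) * of_real (monomial_eval m \<alpha>))"
proof -
  have "Poly_Mapping.keys (Poly_Mapping.map h f) \<subseteq> Poly_Mapping.keys f"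
    by (auto simp: in_keys_iff Poly_Mapping.map.rep_eq when_def)
  then show ?thesis
    by (subst eval_at_superset[of "Poly_Mapping.keys f"])
      (auto simp: Poly_Mapping.map.rep_eq when_def assms in_keys_iff intro!: sum.cong)
qed

text \<open>At real points monomials take real values, so conjugating coefficients conjugates the
  value; \<open>Re\<close> and \<open>Im\<close> pass through evaluation for the same
  reason.\<close>

lemma eval_at_conj_poly: "eval_at \<alpha> (conj_poly p) = cnj (eval_at \<alpha> p)"
  by (simp add: conj_poly_def eval_at_map) (simp add: eval_at_def)

lemma eval_at_map_Re: "eval_at \<alpha> (Poly_Mapping.map Re p) = Re (eval_at \<alpha> p)"
  by (simp add: eval_at_map) (simp add: eval_at_def)

lemma eval_at_map_Im: "eval_at \<alpha> (Poly_Mapping.map Im p) = Im (eval_at \<alpha> p)"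
  by (simp add: eval_at_map) (simp add: eval_at_def)

lemma eval_sq_abs: "eval (sq_abs p) \<alpha> = (cmod (eval_at \<alpha> p))\<^sup>2"
  by (simp add: eval_eq_eval_at sq_abs_def eval_at_map_Re eval_at_mult eval_at_conj_poly
      complex_mult_cnj cmod_power2)

text \<open>Matches the limit condition with \<open>inverse_approximable\<close>: the polynomial
  inside \<open>sq_abs\<close> has real values, so its squared modulus is an ordinary
  square.\<close>

lemma eval_sq_abs_one_minus:
  "eval (sq_abs (1 - (1 + (var j)\<^sup>2) * (q * conj_poly q))) \<alpha> =
    (1 - (1 + (\<alpha> j)\<^sup>2) * ((eval (Poly_Mapping.map Re q) \<alpha>)\<^sup>2 + (eval (Poly_Mapping.map Im q) \<alpha>)\<^sup>2))\<^sup>2"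
proof -
  have "eval_at \<alpha> (1 - (1 + (var j)\<^sup>2) * (q * conj_poly q)) = complex_of_real
    (1 - (1 + (\<alpha> j)\<^sup>2) * ((eval (Poly_Mapping.map Re q) \<alpha>)\<^sup>2 + (eval (Poly_Mapping.map Im q) \<alpha>)\<^sup>2))"
    by (simp add: eval_eq_eval_at eval_at_diff eval_at_add eval_at_mult eval_at_power eval_at_conj_poly
        eval_at_map_Re eval_at_map_Im complex_mult_cnj)
  then show ?thesis
    by (simp only: eval_sq_abs norm_of_real power2_abs)
qed

section \<open>Closure properties of the polynomial algebras\<close>

lemma poly_alg_mono: "I \<subseteq> J \<Longrightarrow> poly_alg I \<subseteq> poly_alg J"
  by (auto simp: poly_alg_def)

lemma poly_alg_add: "f \<in> poly_alg J \<Longrightarrow> g \<in> poly_alg J \<Longrightarrow> f + g \<in> poly_alg J"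
  using Poly_Mapping.keys_add[of f g] unfolding poly_alg_def by blast

lemma poly_alg_diff:
  fixes f g :: "('i, 'a::ab_group_add) mvpoly"
  assumes "f \<in> poly_alg J" "g \<in> poly_alg J" shows "f - g \<in> poly_alg J"
proof -
  have "Poly_Mapping.keys (f - g) \<subseteq> Poly_Mapping.keys f \<union> Poly_Mapping.keys g"
    by (auto simp: in_keys_iff lookup_minus)
  then show ?thesis
    using assms unfolding poly_alg_def by blast
qed

lemma poly_alg_mult:
  fixes f g :: "('i, 'a::semiring_0) mvpoly"
  assumes "f \<in> poly_alg J" "g \<in> poly_alg J" shows "f * g \<in> poly_alg J"
  unfolding poly_alg_def
proof (intro CollectI ballI)
  fix m assume "m \<in> Poly_Mapping.keys (f * g)"
  then obtain k l where kl: "m = k + l" "k \<in> Poly_Mapping.keys f" "l \<in> Poly_Mapping.keys g"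
    using Poly_Mapping.keys_mult[of f g] by auto
  have "Poly_Mapping.keys m \<subseteq> Poly_Mapping.keys k \<union> Poly_Mapping.keys l"
    unfolding kl(1) by (rule Poly_Mapping.keys_add)
  then show "Poly_Mapping.keys m \<subseteq> J"
    using assms kl unfolding poly_alg_def by blast
qed

lemma poly_alg_const: "const c \<in> poly_alg J"
  by (auto simp: poly_alg_def const_def)

lemma poly_alg_1: "1 \<in> poly_alg J"
  by (auto simp: poly_alg_def)

lemma poly_alg_var: "j \<in> J \<Longrightarrow> var j \<in> poly_alg J"
  by (auto simp: poly_alg_def var_def)

lemma poly_alg_power: "(f::('i, 'a::semiring_1) mvpoly) \<in> poly_alg J \<Longrightarrow> f ^ n \<in> poly_alg J"
  by (induction n) (simp_all add: poly_alg_1 poly_alg_mult)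

lemma poly_alg_map: "f \<in> poly_alg J \<Longrightarrow> Poly_Mapping.map h f \<in> poly_alg J"
  by (auto simp: poly_alg_def in_keys_iff Poly_Mapping.map.rep_eq when_def subset_iff split: if_splits)

lemma poly_alg_sq_abs: "p \<in> poly_alg J \<Longrightarrow> sq_abs p \<in> poly_alg J"
  by (simp add: sq_abs_def conj_poly_def poly_alg_map poly_alg_mult)

lemma eval_cong:
  assumes "f \<in> poly_alg J" "\<And>i. i \<in> J \<Longrightarrow> \<alpha> i = \<beta> i"
  shows "eval f \<alpha> = eval f \<beta>"
  unfolding eval_def
proof (intro sum.cong prod.cong refl arg_cong2[of _ _ _ _ "(*)"])
  fix m i assume "m \<in> Poly_Mapping.keys f" "i \<in> Poly_Mapping.keys m"
  then have "i \<in> J" using assms(1) by (auto simp: poly_alg_def)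
  then show "\<alpha> i ^ Poly_Mapping.lookup m i = \<beta> i ^ Poly_Mapping.lookup m i"
    using assms(2) by simp
qed

section \<open>Growth of polynomials against products of \<open>1 + x_j^2\<close>\<close>

lemma abs_prod_power_le_denom:
  assumes "finite S"
  shows "\<exists>js. set js \<subseteq> S \<and> (\<forall>\<alpha>::'i \<Rightarrow> real. \<bar>\<Prod>i\<in>S. \<alpha> i ^ k i\<bar> \<le> denom (map (\<lambda>j \<alpha>. \<alpha> j) js) \<alpha>)"
  using assms
proof (induction S)
  case (insert i S)
  then obtain js where js: "set js \<subseteq> S"
    "\<And>\<alpha>. \<bar>\<Prod>i\<in>S. \<alpha> i ^ k i\<bar> \<le> denom (map (\<lambda>j \<alpha>. \<alpha> j) js) \<alpha>" by blast
  \<comment> \<open>Each power of \<open>x_i\<close> costs one factor \<open>1 + x_i^2\<close>,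
    hence \<open>k i\<close> copies of \<open>i\<close>.\<close>
  have "\<bar>\<Prod>j\<in>insert i S. \<alpha> j ^ k j\<bar> \<le> denom (map (\<lambda>j \<alpha>. \<alpha> j) (replicate (k i) i @ js)) \<alpha>" for \<alpha>
  proof -
    \<comment> \<open>With \<open>a = \<alpha> i\<close>, the right side is
      \<open>2 * (1 + a^2 - |a|)\<close>.\<close>
    have "0 \<le> (\<bar>\<alpha> i\<bar> - 1)\<^sup>2 + (\<alpha> i)\<^sup>2 + 1" by simp
    then have "\<bar>\<alpha> i\<bar> \<le> 1 + (\<alpha> i)\<^sup>2" by (simp add: power2_diff)
    then have "\<bar>\<alpha> i ^ k i\<bar> \<le> denom (map (\<lambda>j \<alpha>. \<alpha> j) (replicate (k i) i)) \<alpha>"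
      by (simp add: denom_def power_abs power_mono)
    then have "\<bar>\<alpha> i ^ k i\<bar> * \<bar>\<Prod>j\<in>S. \<alpha> j ^ k j\<bar>
        \<le> denom (map (\<lambda>j \<alpha>. \<alpha> j) (replicate (k i) i)) \<alpha> * denom (map (\<lambda>j \<alpha>. \<alpha> j) js) \<alpha>"
      by (intro mult_mono js) (auto intro: less_imp_le denom_pos)
    then show ?thesis
      using insert by (simp add: abs_mult denom_append)
  qed
  moreover have "set (replicate (k i) i @ js) \<subseteq> insert i S"
    using js(1) by auto
  ultimately show ?case by blast
qed simp

text \<open>Bounds for single monomials combine by appending lists, since additional factors are at
  least 1.\<close>

lemma eval_le_denom:
  assumes "f \<in> poly_alg J"
  obtains js C where "set js \<subseteq> J" "\<And>\<alpha>. \<bar>eval f \<alpha>\<bar> \<le> C * denom (map (\<lambda>j \<alpha>. \<alpha> j) js) \<alpha>"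
proof -
  \<comment> \<open>\<open>C \<ge> 0\<close> is carried along so that the bound survives additional
    factors.\<close>
  have "\<exists>js C. set js \<subseteq> J \<and> C \<ge> 0 \<and> (\<forall>\<alpha>. \<bar>\<Sum>m\<in>K. Poly_Mapping.lookup f m * monomial_eval m \<alpha>\<bar>
      \<le> C * denom (map (\<lambda>j \<alpha>. \<alpha> j) js) \<alpha>)"
    if "finite K" "K \<subseteq> Poly_Mapping.keys f" for K
    using that
  proof (induction K)
    case empty
    show ?case by (rule exI[of _ "[]"], rule exI[of _ 0]) simp
  next
    case (insert m K)
    then obtain js C where js: "set js \<subseteq> J" and C: "C \<ge> 0"
      and le: "\<And>\<alpha>. \<bar>\<Sum>m\<in>K. Poly_Mapping.lookup f m * monomial_eval m \<alpha>\<bar> \<le> C * denom (map (\<lambda>j \<alpha>. \<alpha> j) js) \<alpha>"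
      by auto
    have "Poly_Mapping.keys m \<subseteq> J"
      using insert.prems assms by (auto simp: poly_alg_def)
    then obtain ks where ks: "set ks \<subseteq> J"
      and le': "\<And>\<alpha>. \<bar>monomial_eval m \<alpha>\<bar> \<le> denom (map (\<lambda>j \<alpha>. \<alpha> j) ks) \<alpha>"
      using abs_prod_power_le_denom[OF finite_keys, of m "Poly_Mapping.lookup m"]
      unfolding monomial_eval_def by (meson subset_trans)
    let ?c = "Poly_Mapping.lookup f m"
    have "\<bar>?c * monomial_eval m \<alpha> + (\<Sum>m\<in>K. Poly_Mapping.lookup f m * monomial_eval m \<alpha>)\<bar>
        \<le> (\<bar>?c\<bar> + C) * denom (map (\<lambda>j \<alpha>. \<alpha> j) (ks @ js)) \<alpha>" for \<alpha>
    proof -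
      let ?D = "\<lambda>js. denom (map (\<lambda>j \<alpha>. \<alpha> j) js) \<alpha>"
      have "\<bar>?c * monomial_eval m \<alpha>\<bar> \<le> \<bar>?c\<bar> * (?D ks * ?D js)"
        unfolding abs_mult using le'[of \<alpha>] denom_ge_1[of "map (\<lambda>j \<alpha>. \<alpha> j) js" \<alpha>]
        by (intro mult_left_mono order.trans[OF le'[of \<alpha>]]) (auto simp: mult_le_cancel_left1)
      moreover have "C * ?D js \<le> C * (?D ks * ?D js)"
        using denom_ge_1[of "map (\<lambda>j \<alpha>. \<alpha> j) ks" \<alpha>] denom_pos[of "map (\<lambda>j \<alpha>. \<alpha> j) js" \<alpha>] C
        by (intro mult_left_mono) (auto simp: mult_le_cancel_right1)
      ultimately show ?thesis
        using le[of \<alpha>] by (simp add: denom_append distrib_right)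
    qed
    then show ?case
      using insert.hyps js ks C
      by (intro exI[of _ "ks @ js"] exI[of _ "\<bar>?c\<bar> + C"]) simp
  qed
  from this[OF finite_keys subset_refl] show thesis
    using that unfolding eval_eq_eval_at eval_at_def of_real_eq_id id_apply by blast
qed

text \<open>As \<open>I\<close> is countable, the sets where a member of \<open>M\<^sub>0\<close> is negative come from open sets of the
  second countable space \<open>\<real>\<^sup>\<nat>\<close>, where Lindelof's theorem applies.\<close>

lemma countable_negativity_witnesses:
  assumes I: "countable I" and M\<^sub>0: "M\<^sub>0 \<subseteq> poly_alg I"
  obtains N where "N \<subseteq> M\<^sub>0" "countable N"
    "\<And>g \<alpha>. g \<in> M\<^sub>0 \<Longrightarrow> eval g \<alpha> < 0 \<Longrightarrow> \<exists>g'\<in>N. eval g' \<alpha> < 0"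
proof -
  \<comment> \<open>The injection \<open>to_nat_on I\<close> renames the variables in
    \<open>I\<close>, which moves the problem to real sequences.\<close>
  define U where "U g = {\<beta> :: nat \<Rightarrow> real. eval g (\<lambda>i. \<beta> (to_nat_on I i)) < 0}" for g
  have openU: "open (U g)" for g
    unfolding U_def eval_def by (intro open_Collect_less continuous_intros continuous_on_product_coordinates)
  obtain \<U> where \<U>: "\<U> \<subseteq> U ` M\<^sub>0" "countable \<U>" "\<Union>\<U> = \<Union>(U ` M\<^sub>0)"
    by (rule Lindelof[of "U ` M\<^sub>0"]) (use openU in auto)
  then obtain N where N: "N \<subseteq> M\<^sub>0" "countable N" "\<U> = U ` N"
    by (metis countable_subset_image)
  have mem_U: "(\<lambda>n. \<alpha> (from_nat_into I n)) \<in> U g \<longleftrightarrow> eval g \<alpha> < 0" if "g \<in> M\<^sub>0" for g \<alpha>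
  proof -
    \<comment> \<open>\<open>from_nat_into I\<close> undoes \<open>to_nat_on I\<close> on
      \<open>I\<close>, and \<open>g\<close> involves no other variables.\<close>
    have "eval g (\<lambda>i. \<alpha> (from_nat_into I (to_nat_on I i))) = eval g \<alpha>"
      using that M\<^sub>0 I by (intro eval_cong[of g I]) auto
    then show ?thesis by (simp add: U_def)
  qed
  show thesis
  proof (rule that[OF N(1,2)])
    fix g \<alpha> assume g: "g \<in> M\<^sub>0" "eval g \<alpha> < 0"
    then have "(\<lambda>n. \<alpha> (from_nat_into I n)) \<in> \<Union>(U ` M\<^sub>0)"
      using mem_U by blast
    then show "\<exists>g'\<in>N. eval g' \<alpha> < 0"
      using \<U>(3) N mem_U by blast
  qed
qed


section \<open>The support of the associated measure\<close>

lemma quadratic_module_hull_sq_mult: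
  "h \<in> D \<Longrightarrow> g \<in> M\<^sub>0 \<Longrightarrow> h\<^sup>2 * g \<in> quadratic_module D hull M\<^sub>0"
  by (auto simp: hull_def quadratic_module_def)

text \<open>The polynomials nonnegative at a fixed point form a quadratic module, so inequalities
  for the generators pass to the whole extension.\<close>

lemma X_set_quadratic_module_extension:
  assumes M\<^sub>0: "M\<^sub>0 \<subseteq> poly_alg \<Omega>"
  shows "X_set \<Omega> (quadratic_module_extension \<Omega> M\<^sub>0) = X_set \<Omega> M\<^sub>0"
proof
  show "X_set \<Omega> (quadratic_module_extension \<Omega> M\<^sub>0) \<subseteq> X_set \<Omega> M\<^sub>0"
    unfolding X_set_def quadratic_module_extension_def using hull_subset[of M\<^sub>0] by blast
  show "X_set \<Omega> M\<^sub>0 \<subseteq> X_set \<Omega> (quadratic_module_extension \<Omega> M\<^sub>0)"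
  proof
    fix \<alpha> assume \<alpha>: "\<alpha> \<in> X_set \<Omega> M\<^sub>0"
    have "quadratic_module_extension \<Omega> M\<^sub>0 \<subseteq> {g \<in> poly_alg \<Omega>. eval g \<alpha> \<ge> 0}"
      unfolding quadratic_module_extension_def
    proof (rule hull_minimal)
      show "M\<^sub>0 \<subseteq> {g \<in> poly_alg \<Omega>. eval g \<alpha> \<ge> 0}"
        using \<alpha> M\<^sub>0 by (auto simp: X_set_def)
      show "quadratic_module (poly_alg \<Omega>) {g \<in> poly_alg \<Omega>. eval g \<alpha> \<ge> 0}"
        by (auto simp: quadratic_module_def eval_eq_eval_at eval_at_add eval_at_mult eval_at_power
            poly_alg_1 poly_alg_add poly_alg_mult poly_alg_power)
    qed
    then show "\<alpha> \<in> X_set \<Omega> (quadratic_module_extension \<Omega> M\<^sub>0)"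
      using \<alpha> by (auto simp: X_set_def)
  qed
qed

section \<open>The space underlying \<open>\<nu>\<close> and integrability of polynomials\<close>

lemma space_constructibly_Radon_on_power:
  assumes "constructibly_Radon_on_power \<Omega> \<nu>"
  shows "space \<nu> = \<Omega> \<rightarrow>\<^sub>E UNIV"
proof -
  have "sets \<nu> = sets (vimage_algebra (\<Omega> \<rightarrow>\<^sub>E UNIV) (point_evaluation \<Omega>) (constructible_borel (poly_alg \<Omega>)))"
    using assms by (simp add: constructibly_Radon_on_power_def)
  from sets_eq_imp_space_eq[OF this] show ?thesis by simp
qed

text \<open>Finite moments settle the monomials; polynomials are finite linear combinations of
  them.\<close>

lemma integrable_eval:
  assumes \<nu>: "constructibly_Radon_on_power \<Omega> \<nu>" and f: "f \<in> poly_alg \<Omega>"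
  shows "integrable \<nu> (eval f)"
proof -
  have "integrable \<nu> (monomial_eval m)" if "m \<in> Poly_Mapping.keys f" for m
  proof -
    have "eval (monomial m) = monomial_eval m"
      by (simp add: fun_eq_iff eval_eq_eval_at monomial_def)
    moreover have "Poly_Mapping.keys m \<subseteq> \<Omega>"
      using f that by (auto simp: poly_alg_def)
    ultimately show ?thesis
      using \<nu> by (metis constructibly_Radon_on_power_def)
  qed
  then show ?thesis
    by (simp add: eval_eq_eval_at[abs_def] eval_at_def)
qed

theorem proposition5p2:
  fixes \<Omega> :: "'i set"
    and L :: "('i, real) mvpoly \<Rightarrow> real"
    and M :: "('i, real) mvpoly set"
    and \<nu> :: "('i \<Rightarrow> real) measure"
  assumes "linear_functional_on (poly_alg \<Omega>) L"
    and "PSD_on (poly_alg \<Omega>) L"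
    and "\<forall>j \<in> \<Omega>. \<exists>q :: nat \<Rightarrow> ('i, complex) mvpoly. (\<forall>k. q k \<in> poly_alg \<Omega>) \<and>
           (\<lambda>k. L (sq_abs (1 - (1 + (var j)\<^sup>2) * (q k * conj_poly (q k))))) \<longlonglongrightarrow> 0"
    and "\<exists>I M\<^sub>0. I \<subseteq> \<Omega> \<and> countable I \<and> quadratic_module (poly_alg I) M\<^sub>0 \<and>
           M = quadratic_module_extension \<Omega> M\<^sub>0"
    and "\<forall>g \<in> M. L g \<ge> 0"
    and "associated_measure \<Omega> L \<nu>"
  shows "supported_by \<nu> (X_set \<Omega> M)"
proof -
  have \<nu>: "constructibly_Radon_on_power \<Omega> \<nu>"
    and L: "\<And>f. f \<in> poly_alg \<Omega> \<Longrightarrow> L f = (\<integral>\<alpha>. eval f \<alpha> \<partial>\<nu>)"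
    using assms(6) by (auto simp: associated_measure_def)
  obtain I M\<^sub>0 where I: "I \<subseteq> \<Omega>" "countable I" and M\<^sub>0: "M\<^sub>0 \<subseteq> poly_alg I"
    and M: "M = quadratic_module_extension \<Omega> M\<^sub>0"
    using assms(4) by (auto simp: quadratic_module_def)
  have M\<^sub>0_\<Omega>: "M\<^sub>0 \<subseteq> poly_alg \<Omega>"
    using M\<^sub>0 poly_alg_mono[OF I(1)] by blast
  interpret integrable_function_algebra \<nu> "eval ` poly_alg \<Omega>"
  proof
    show "(\<lambda>_. c) \<in> eval ` poly_alg \<Omega>" for c
      by (rule image_eqI[of _ _ "const c"]) (simp_all add: fun_eq_iff eval_eq_eval_at poly_alg_const)
  next
    fix f g assume "f \<in> eval ` poly_alg \<Omega>" "g \<in> eval ` poly_alg \<Omega>"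
    then obtain f' g' where fg: "f = eval f'" "f' \<in> poly_alg \<Omega>" "g = eval g'" "g' \<in> poly_alg \<Omega>"
      by blast
    show "(\<lambda>\<alpha>. f \<alpha> + g \<alpha>) \<in> eval ` poly_alg \<Omega>"
      by (rule image_eqI[of _ _ "f' + g'"])
        (simp_all add: fg fun_eq_iff eval_eq_eval_at eval_at_add poly_alg_add)
    show "(\<lambda>\<alpha>. f \<alpha> * g \<alpha>) \<in> eval ` poly_alg \<Omega>"
      by (rule image_eqI[of _ _ "f' * g'"])
        (simp_all add: fg fun_eq_iff eval_eq_eval_at eval_at_mult poly_alg_mult)
  qed (use integrable_eval[OF \<nu>] in auto)
  \<comment> \<open>Translates the limit condition from \<open>L\<close> to integrals, with
    \<open>q_k\<close> split into real and imaginary parts.\<close>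
  have coord: "(\<lambda>\<alpha>. \<alpha> j) \<in> inverse_approximable" if j: "j \<in> \<Omega>" for j
  proof -
    obtain q :: "nat \<Rightarrow> ('i, complex) mvpoly" where q: "\<And>k. q k \<in> poly_alg \<Omega>"
      and lim: "(\<lambda>k. L (sq_abs (1 - (1 + (var j)\<^sup>2) * (q k * conj_poly (q k))))) \<longlonglongrightarrow> 0"
      using assms(3) j by blast
    define u where "u k = eval (Poly_Mapping.map Re (q k))" for k
    define v where "v k = eval (Poly_Mapping.map Im (q k))" for k
    have "sq_abs (1 - (1 + (var j)\<^sup>2) * (q k * conj_poly (q k))) \<in> poly_alg \<Omega>" for k
      using j q[of k] unfolding conj_poly_def
      by (intro poly_alg_sq_abs poly_alg_diff poly_alg_mult poly_alg_add poly_alg_power poly_alg_1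
          poly_alg_var poly_alg_map)
    then have "L (sq_abs (1 - (1 + (var j)\<^sup>2) * (q k * conj_poly (q k)))) =
        (\<integral>\<alpha>. (1 - (1 + (\<alpha> j)\<^sup>2) * ((u k \<alpha>)\<^sup>2 + (v k \<alpha>)\<^sup>2))\<^sup>2 \<partial>\<nu>)" for k
      by (simp add: L eval_sq_abs_one_minus u_def v_def)
    with lim have "(\<lambda>k. \<integral>\<alpha>. (1 - (1 + (\<alpha> j)\<^sup>2) * ((u k \<alpha>)\<^sup>2 + (v k \<alpha>)\<^sup>2))\<^sup>2 \<partial>\<nu>) \<longlonglongrightarrow> 0"
      by simp
    moreover have "\<forall>k. u k \<in> eval ` poly_alg \<Omega> \<and> v k \<in> eval ` poly_alg \<Omega>"
      using q by (auto simp: u_def v_def poly_alg_map)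
    moreover have "(\<lambda>\<alpha>. \<alpha> j) \<in> eval ` poly_alg \<Omega>"
      by (rule image_eqI[of _ _ "var j"]) (simp_all add: fun_eq_iff eval_eq_eval_at j poly_alg_var)
    ultimately show ?thesis
      unfolding inverse_approximable_def by blast
  qed
  have nonneg: "AE \<alpha> in \<nu>. eval g \<alpha> \<ge> 0" if g: "g \<in> M\<^sub>0" for g
  proof -
    have g_\<Omega>: "g \<in> poly_alg \<Omega>" using g M\<^sub>0_\<Omega> by blast
    obtain js C where js: "set js \<subseteq> \<Omega>"
      and bound: "\<And>\<alpha>. \<bar>eval g \<alpha>\<bar> \<le> C * denom (map (\<lambda>j \<alpha>. \<alpha> j) js) \<alpha>"
      using eval_le_denom[OF g_\<Omega>] by blast
    show ?thesis
    proof (rule AE_nonneg_of_integral_sq_mult_nonneg[OF _ _ _ bound])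
      show "eval g \<in> eval ` poly_alg \<Omega>" using g_\<Omega> by blast
      show "set (map (\<lambda>j \<alpha>. \<alpha> j) js) \<subseteq> inverse_approximable"
        using js coord by auto
      fix f assume "f \<in> eval ` poly_alg \<Omega>"
      then obtain h where h: "f = eval h" "h \<in> poly_alg \<Omega>" by blast
      \<comment> \<open>\<open>h^2 * g\<close> lies in \<open>M\<close>, where \<open>L\<close> is
        nonnegative.\<close>
      have "0 \<le> L (h\<^sup>2 * g)"
        using assms(5) quadratic_module_hull_sq_mult[OF h(2) g]
        by (simp add: M quadratic_module_extension_def)
      then show "0 \<le> (\<integral>\<alpha>. (f \<alpha>)\<^sup>2 * eval g \<alpha> \<partial>\<nu>)"
        using h g_\<Omega> by (simp add: L poly_alg_mult poly_alg_power eval_eq_eval_at eval_at_mult eval_at_power)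
    qed
  qed
  obtain N where N: "N \<subseteq> M\<^sub>0" "countable N"
    "\<And>g \<alpha>. g \<in> M\<^sub>0 \<Longrightarrow> eval g \<alpha> < 0 \<Longrightarrow> \<exists>g'\<in>N. eval g' \<alpha> < 0"
    using countable_negativity_witnesses[OF I(2) M\<^sub>0] by blast
  \<comment> \<open>Exceptional null sets are united over the countable \<open>N\<close> only;
    \<open>M\<^sub>0\<close> itself may be uncountable.\<close>
  have "AE \<alpha> in \<nu>. \<forall>g\<in>N. eval g \<alpha> \<ge> 0"
    using N nonneg by (subst AE_ball_countable) auto
  \<comment> \<open>The witnesses in \<open>N\<close> control all of \<open>M\<^sub>0\<close>;
    \<open>AE_space\<close> puts \<open>\<alpha>\<close> into
    \<open>\<Omega> \<rightarrow>\<^sub>E UNIV\<close>, as \<open>X_set\<close> demands.\<close>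
  then have "AE \<alpha> in \<nu>. \<alpha> \<in> X_set \<Omega> M\<^sub>0"
    using AE_space
  proof eventually_elim
    case (elim \<alpha>)
    then have "eval g \<alpha> \<ge> 0" if "g \<in> M\<^sub>0" for g
      using N(3)[OF that, of \<alpha>] by (force simp: not_less)
    then show ?case
      using elim(2) space_constructibly_Radon_on_power[OF \<nu>] by (simp add: X_set_def)
  qed
  then have ae: "AE \<alpha> in \<nu>. \<alpha> \<in> X_set \<Omega> M"
    by (simp add: M X_set_quadratic_module_extension[OF M\<^sub>0_\<Omega>])
  show ?thesis
    unfolding supported_by_def
  proof (intro ballI impI)
    fix E assume E: "E \<in> sets \<nu>" "E \<inter> X_set \<Omega> M = {}"
    have "AE \<alpha> in \<nu>. \<alpha> \<notin> E"
      using ae by eventually_elim (use E in auto)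
    then show "emeasure \<nu> E = 0"
      using E(1) AE_iff_null_sets by blast
  qed
qed

end
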